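(* Let $G=(V(G),E(G),w)$ be a finite weighted graph with $w:E(G)\to\mathbb{R}_{\ge 0}$ and order $n\ge 2$. Then $G$ admits a bipartition $(X,Y)$ of $V(G)$ into two non-empty parts such that both (i) $w(X,Y)\ge \frac{w(G)}{2}+\frac{d_w(G)}{4}$, and (ii) $\max\{w(G[X]),w(G[Y])\}\le \frac{w(G)}{4}+\frac{\Delta_w(G)}{8}$.
   Context: For a weighted graph $G$, $w(G)$ is the total weight of its edges and $w(G[S])$ is the total weight of edges with both endpoints in $S\subseteq V(G)$. The weighted degree of a vertex $v$ is $w(v)=\sum_{u\in N(v)}w(vu)$; $\Delta_w(G)=\max_{v}w(v)$ is the maximum weighted degree and $d_w(G)=\frac{1}{|V(G)|}\sum_v w(v)=\frac{2w(G)}{|V(G)|}$ is the average weighted degree. For disjoint non-empty sets $X_1,\dots,X_k$, $w(X_1,\dots,X_k)$ denotes the total weight of edges with endpoints in two different sets $X_i,X_j$, $i\ne j$. *)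

theory Defs
  imports Complex_Main
begin

text \<open>
  Finite simple graphs with vertex set V, edges given as two-element subsets of V, and a
  non-negative weight on each edge.  The values of w outside E are irrelevant: every quantity
  below only evaluates w on elements of E.
\<close>

locale weighted_graph =
  fixes V :: "'a set" and E :: "'a set set" and w :: "'a set \<Rightarrow> real"
  assumes finite_vertices: "finite V"
    and edges: "e \<in> E \<Longrightarrow> e \<subseteq> V \<and> card e = 2"
    and nonneg_weight: "e \<in> E \<Longrightarrow> 0 \<le> w e"

definition neighbours :: "'a set set \<Rightarrow> 'a \<Rightarrow> 'a set" where
  "neighbours E v = {u. {v, u} \<in> E}"

definition total_weight :: "'a set set \<Rightarrow> ('a set \<Rightarrow> real) \<Rightarrow> real" where
  "total_weight E w = (\<Sum>e\<in>E. w e)"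

definition induced_edges :: "'a set set \<Rightarrow> 'a set \<Rightarrow> 'a set set" where
  "induced_edges E S = {e \<in> E. e \<subseteq> S}"

definition weighted_degree :: "'a set set \<Rightarrow> ('a set \<Rightarrow> real) \<Rightarrow> 'a \<Rightarrow> real" where
  "weighted_degree E w v = (\<Sum>u\<in>neighbours E v. w {v, u})"

definition max_weighted_degree :: "'a set \<Rightarrow> 'a set set \<Rightarrow> ('a set \<Rightarrow> real) \<Rightarrow> real" where
  "max_weighted_degree V E w = Max (weighted_degree E w ` V)"

definition avg_weighted_degree :: "'a set \<Rightarrow> 'a set set \<Rightarrow> ('a set \<Rightarrow> real) \<Rightarrow> real" where
  "avg_weighted_degree V E w = (\<Sum>v\<in>V. weighted_degree E w v) / real (card V)"

definition cut_weight :: "'a set set \<Rightarrow> ('a set \<Rightarrow> real) \<Rightarrow> 'a set \<Rightarrow> 'a set \<Rightarrow> real" where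
  "cut_weight E w X Y = (\<Sum>e\<in>{e \<in> E. \<exists>x\<in>X. \<exists>y\<in>Y. e = {x, y}}. w e)"

definition bipartition :: "'a set \<Rightarrow> 'a set \<Rightarrow> 'a set \<Rightarrow> bool" where
  "bipartition V X Y \<longleftrightarrow> X \<noteq> {} \<and> Y \<noteq> {} \<and> X \<inter> Y = {} \<and> X \<union> Y = V"

end

theory Submission
  imports Defs
begin

text \<open>
  A bipartition with \<open>w(X,Y) \<ge> w(G)/2 + w(G)/(2n)\<close> is built by adding the vertices in pairs, the two
  vertices of a pair on different sides; averaging over all pairs shows that a suitable pair exists.

  Now take a maximum cut \<open>(X, Y)\<close> and write \<open>a = w(G[X])\<close>, \<open>c = w(X,Y)\<close>. If
  \<open>a > w(G)/4 + \<Delta>/8\<close>, then maximality gives \<open>c \<ge> 2a\<close>. For \<open>v \<in> X\<close> let \<open>x\<close> and \<open>y\<close> be the weights from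
  \<open>v\<close> to \<open>X\<close> and to \<open>Y\<close>. These sum to \<open>2a\<close> and \<open>c\<close> over \<open>X\<close>, so some \<open>v\<close> has \<open>x > 0\<close> and
  \<open>2ay \<le> cx\<close>. Moving such vertices to \<open>Y\<close> keeps \<open>c \<ge> 2a\<close> as long as \<open>a > w(G)/4 + \<Delta>/8\<close>, and the move
  that first violates the latter inequality yields a bipartition with both properties.
\<close>

section \<open>Symmetric weight functions and the effect of moving a vertex\<close>

locale symmetric_weights =
  fixes f :: "'a \<Rightarrow> 'a \<Rightarrow> real"
  assumes sym: "f u v = f v u"
    and diag [simp]: "f u u = 0"
begin

text \<open>Ordered pairs are summed, so each pair inside \<open>A\<close> enters
  \<open>wt A A\<close> twice, while for disjoint sets \<open>wt\<close> is the plain cut weight.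
  Hence the constants below are rescaled: \<open>wt V V\<close> stands for twice the total
  weight.\<close>

definition wt :: "'a set \<Rightarrow> 'a set \<Rightarrow> real" where
  "wt A B = (\<Sum>a\<in>A. \<Sum>b\<in>B. f a b)"

lemma wt_commute: "wt A B = wt B A"
  unfolding wt_def by (subst sum.swap) (simp add: sym)

lemma wt_empty [simp]: "wt {} B = 0" "wt A {} = 0"
  by (simp_all add: wt_def)

lemma wt_insert_left: "finite A \<Longrightarrow> v \<notin> A \<Longrightarrow> wt (insert v A) B = sum (f v) B + wt A B"
  by (simp add: wt_def)

lemma wt_insert_right:
  assumes "finite B" "v \<notin> B"
  shows "wt A (insert v B) = sum (f v) A + wt A B"
  using wt_insert_left[OF assms, of A] by (simp add: wt_commute)

lemma wt_insert_insert:
  assumes "finite A" "v \<notin> A"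
  shows "wt (insert v A) (insert v A) = 2 * sum (f v) A + wt A A"
  using assms by (simp add: wt_insert_left wt_insert_right)

lemma wt_split:
  assumes "finite V" "X \<subseteq> V"
  shows "wt V V = wt X X + wt (V - X) (V - X) + 2 * wt X (V - X)"
proof -
  have "wt V B = wt X B + wt (V - X) B" for B
    using assms by (simp add: wt_def sum.subset_diff[of X V] add.commute)
  then show ?thesis
    using wt_commute[of V X] wt_commute[of V "V - X"] wt_commute[of X "V - X"] by simp
qed

lemma move_vertex:
  assumes "finite V" "X \<subseteq> V" "v \<in> X"
  defines "x \<equiv> sum (f v) X" and "y \<equiv> sum (f v) (V - X)"
  shows "wt (X - {v}) (X - {v}) = wt X X - 2 * x"
    and "wt (V - (X - {v})) (V - (X - {v})) = wt (V - X) (V - X) + 2 * y"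
    and "wt (X - {v}) (V - (X - {v})) = wt X (V - X) + x - y"
proof -
  have fin: "finite X" "finite (V - X)" using assms finite_subset by auto
  have x: "x = sum (f v) (X - {v})"
    unfolding x_def using fin assms by (simp add: sum.remove[of X v])
  have Y: "V - (X - {v}) = insert v (V - X)" using assms by auto
  have X: "X = insert v (X - {v})" using assms by auto
  have "wt X X = 2 * x + wt (X - {v}) (X - {v})"
    using wt_insert_insert[of "X - {v}" v] fin x X by simp
  then show "wt (X - {v}) (X - {v}) = wt X X - 2 * x" by simp
  show "wt (V - (X - {v})) (V - (X - {v})) = wt (V - X) (V - X) + 2 * y"
    unfolding Y using fin assms by (simp add: wt_insert_insert)
  have "wt X (V - X) = y + wt (X - {v}) (V - X)"
    using wt_insert_left[of "X - {v}" v "V - X"] fin X by (simp add: y_def)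
  moreover have "wt (X - {v}) (insert v (V - X)) = x + wt (X - {v}) (V - X)"
    using fin assms x by (simp add: wt_insert_right)
  ultimately show "wt (X - {v}) (V - (X - {v})) = wt X (V - X) + x - y"
    unfolding Y by simp
qed

text \<open>The expression averages to zero over ordered pairs of distinct vertices: summed over
  \<open>v\<close>, it gives the degree of \<open>u\<close> minus the average degree. For more than
  two vertices, its sign says that deleting \<open>u\<close> and \<open>v\<close> lowers the average
  degree by at most \<open>2 * f u v\<close>, which is what the induction for large cuts
  consumes.\<close>

lemma exists_heavy_pair:
  assumes "finite V" and n: "card V \<ge> 2"
  shows "\<exists>u\<in>V. \<exists>v\<in>V. u \<noteq> v \<and>
    (real (card V) - 1) * f u v - sum (f u) V - sum (f v) V + wt V V / card V \<ge> 0"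
proof (rule ccontr)
  let ?n = "real (card V)"
  let ?g = "\<lambda>u v. (?n - 1) * f u v - sum (f u) V - sum (f v) V + wt V V / ?n"
  assume "\<not> ?thesis"
  then have neg: "?g u v < 0" if "u \<in> V" "v \<in> V" "u \<noteq> v" for u v
    using that by force
  have card: "card (V - {u}) = card V - 1" if "u \<in> V" for u
    using that assms by simp
  have inner: "(\<Sum>v\<in>V - {u}. ?g u v) = sum (f u) V - wt V V / ?n"
    if "u \<in> V" for u
  proof -
    have 1: "(\<Sum>v\<in>V - {u}. f u v) = sum (f u) V"
      using that assms by (simp add: sum.remove[of V u])
    have 2: "(\<Sum>v\<in>V - {u}. sum (f v) V) = wt V V - sum (f u) V"
      using that assms by (simp add: sum.remove[of V u] wt_def)
    have "(\<Sum>v\<in>V - {u}. ?g u v) = (?n - 1) * (\<Sum>v\<in>V - {u}. f u v) - (?n - 1) * sum (f u) V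
        - (\<Sum>v\<in>V - {u}. sum (f v) V) + (?n - 1) * (wt V V / ?n)"
      using n by (simp add: sum.distrib sum_subtractf sum_distrib_left card[OF that] of_nat_diff)
    then show ?thesis unfolding 1 2 using n by (simp add: field_simps)
  qed
  have "(\<Sum>u\<in>V. \<Sum>v\<in>V - {u}. ?g u v) = (\<Sum>u\<in>V. sum (f u) V - wt V V / ?n)"
    by (rule sum.cong[OF refl inner])
  also have "\<dots> = 0"
    using n by (simp add: sum_subtractf wt_def)
  finally have zero: "(\<Sum>u\<in>V. \<Sum>v\<in>V - {u}. ?g u v) = 0" .
  have "(\<Sum>v\<in>V - {u}. ?g u v) < 0" if "u \<in> V" for u
  proof -
    have "V - {u} \<noteq> {}" using card[OF that] n by force
    then have "(\<Sum>v\<in>V - {u}. ?g u v) < (\<Sum>v\<in>V - {u}. 0)"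
      using that assms neg by (intro sum_strict_mono) auto
    then show ?thesis by simp
  qed
  moreover have "V \<noteq> {}" using n by auto
  ultimately have "(\<Sum>u\<in>V. \<Sum>v\<in>V - {u}. ?g u v) < (\<Sum>u\<in>V. 0)"
    using assms by (intro sum_strict_mono) auto
  with zero show False by simp
qed

end

text \<open>Here \<open>a\<close>, \<open>b\<close>, \<open>c\<close> are the weights inside
  \<open>X\<close>, inside \<open>Y\<close> and across, and \<open>x\<close>, \<open>y\<close> are
  the weights from the moved vertex to \<open>X\<close> and to \<open>Y\<close>. The first
  conclusion turns \<open>c \<ge> 2 * a\<close> into the same inequality after the move; the other
  two give the bounds on the receiving side and on the new cut.\<close>

lemma move_estimates:
  fixes a b c x y D W :: real
  assumes W: "a + b + c = W" and a: "a > W / 4 + D / 8" and c: "c \<ge> 2 * a"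
    and nonneg: "0 \<le> b" "0 \<le> x" "0 \<le> y" "0 \<le> W"
    and D: "x + y \<le> D" and x: "x \<le> a" and y: "2 * a * y \<le> c * x"
  shows "y \<le> 3 * x" "b + y \<le> W / 4 + D / 8" "c + x - y \<ge> W / 2 + D / 4"
proof -
  have a0: "a > 0" and D0: "D \<ge> 0" using assms by auto
  have "c * x \<le> (3 * a) * x" using W a nonneg D0 by (intro mult_right_mono) auto
  with y have "a * (2 * y) \<le> a * (3 * x)" by simp
  then show "y \<le> 3 * x" using a0 nonneg by auto
  have "(c - 2 * a) * (2 * x) \<le> (c - 2 * a) * (2 * a)" using c x by (intro mult_left_mono) auto
  then have "2 * a * (y - x) \<le> 2 * a * (c - 2 * a)"
    using y mult_nonneg_nonneg[of "c - 2 * a" x] c nonneg mult_left_mono[OF x, of "c - 2 * a"]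
    by (simp add: algebra_simps)
  then have "y - x \<le> c - 2 * a" using a0 by simp
  then show "c + x - y \<ge> W / 2 + D / 4" using a by simp
  have "c * x \<le> c * (D - y)" using c a0 D by (intro mult_left_mono) auto
  with y have "(2 * a + c) * y \<le> c * D" by (simp add: algebra_simps)
  also have "\<dots> \<le> (2 * a + c) * (c - 2 * a + D / 2)"
  proof -
    \<comment> \<open>This product is the difference of the two sides; its second factor is
      nonnegative since \<open>2 * a + c \<ge> 4 * a > W + D / 2\<close>.\<close>
    have "0 \<le> (c - 2 * a) * (2 * a + c - D / 2)"
      using c a nonneg D0 by (intro mult_nonneg_nonneg) auto
    then show ?thesis by (simp add: algebra_simps)
  qed
  finally have "y \<le> c - 2 * a + D / 2" using a0 c by simp
  then show "b + y \<le> W / 4 + D / 8" using W a by argo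
qed

section \<open>Large cuts and rebalancing for non-negative weights\<close>

locale nonneg_symmetric_weights = symmetric_weights +
  assumes nonneg: "0 \<le> f u v"
begin

lemma wt_nonneg: "0 \<le> wt A B"
  by (simp add: wt_def sum_nonneg nonneg)

text \<open>A heavy pair is removed, the rest is cut by induction, and the better of the two ways to
  separate the pair is kept. A side may be empty here; this is excluded only at the very
  end.\<close>

lemma exists_large_cut:
  assumes "finite V"
  shows "\<exists>X\<subseteq>V. wt X (V - X) \<ge> wt V V / 4 + wt V V / (4 * real (card V))"
  using assms
proof (induction "card V" arbitrary: V rule: less_induct)
  case less
  show ?case
  proof (cases "card V \<ge> 2")
    case False
    then have "card V = 0 \<or> card V = 1" by auto
    with less.prems obtain v where "V = {} \<or> V = {v}" by (auto simp: card_1_singleton_iff)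
    then have "wt V V = 0" by (auto simp: wt_def)
    then show ?thesis by (intro exI[of _ "{}"]) simp
  next
    case True
    let ?n = "real (card V)"
    obtain u v where uv: "u \<in> V" "v \<in> V" "u \<noteq> v"
      and heavy: "(?n - 1) * f u v - sum (f u) V - sum (f v) V + wt V V / ?n \<ge> 0"
      using exists_heavy_pair[OF less.prems True] by blast
    define H where "H = V - {u, v}"
    have V: "V = insert u (insert v H)" and H: "finite H" "u \<notin> H" "v \<notin> H"
      using uv less.prems by (auto simp: H_def)
    have n: "card V = card H + 2" using H uv by (simp add: V)
    then obtain Z where Z: "Z \<subseteq> H" and
      cut: "wt Z (H - Z) \<ge> wt H H / 4 + wt H H / (4 * real (card H))"
      using less.hyps[of H] H by auto
    have fin: "finite Z" "finite (H - Z)" using Z H finite_subset by auto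
    have not_in: "u \<notin> Z" "v \<notin> Z" using Z H by auto
    let ?dH = "\<lambda>x. sum (f x) H"
    have dH: "sum (f x) Z + sum (f x) (H - Z) = ?dH x" for x
      using Z H by (simp add: sum.subset_diff[of Z H] add.commute)
    have "V - insert u Z = insert v (H - Z)" "V - insert v Z = insert u (H - Z)"
      using uv H Z by (auto simp: V)
    then have cuts:
      "wt (insert u Z) (V - insert u Z) = f u v + sum (f u) (H - Z) + sum (f v) Z + wt Z (H - Z)"
      "wt (insert v Z) (V - insert v Z) = f u v + sum (f v) (H - Z) + sum (f u) Z + wt Z (H - Z)"
      using fin not_in H by (simp_all add: wt_insert_left wt_insert_right sym[of v u])
    have VV: "wt V V = 2 * f u v + 2 * ?dH u + 2 * ?dH v + wt H H"
      unfolding V using H uv by (simp add: wt_insert_insert)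
    have deg: "sum (f u) V = f u v + ?dH u" "sum (f v) V = f u v + ?dH v"
      unfolding V using H uv by (simp_all add: sym[of v u])
    \<comment> \<open>For nonempty \<open>H\<close> this is the heavy-pair inequality, rewritten as
      a comparison of the average degrees of \<open>V\<close> and \<open>H\<close>.\<close>
    have key: "wt V V / ?n \<le> 2 * f u v + wt H H / real (card H)"
    proof (cases "card H = 0")
      case True
      then have "H = {}" using H by simp
      \<comment> \<open>With two vertices the left side is \<open>f u v\<close> and the quotient on
        the right is 0, so non-negativity suffices.\<close>
      then show ?thesis using n VV nonneg by simp
    next
      case False
      define m where "m = real (card H)"
      have m: "m > 0" "?n = m + 2" using False n by (simp_all add: m_def)
      define q where "q = wt V V / (m + 2)"
      have "wt V V = q * (m + 2)" using m by (simp add: q_def)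
      then have q: "wt V V = q * m + 2 * q" by (simp add: algebra_simps)
      from heavy have "(m + 1) * f u v - 2 * f u v - ?dH u - ?dH v + q \<ge> 0"
        unfolding deg m q_def by (simp add: algebra_simps)
      with VV q have "q * m \<le> 2 * f u v * m + wt H H"
        by (simp add: algebra_simps)
      then have "q \<le> 2 * f u v + wt H H / m"
        using m by (simp add: field_simps)
      then show ?thesis using m by (simp add: q_def m_def)
    qed
    \<comment> \<open>Each pair joining \<open>u\<close> or \<open>v\<close> to \<open>H\<close> is
      cut by exactly one of the two placements, and the pair \<open>u\<close>, \<open>v\<close> by
      both.\<close>
    have "wt (insert u Z) (V - insert u Z) + wt (insert v Z) (V - insert v Z)
        = 2 * f u v + ?dH u + ?dH v + 2 * wt Z (H - Z)"
      unfolding cuts using dH[of u] dH[of v] by simp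
    also have "\<dots> \<ge> 2 * (wt V V / 4 + wt V V / (4 * ?n))"
    proof -
      have "x / (4 * k) = x / k / 4" for x k :: real by simp
      with key cut VV show ?thesis by argo
    qed
    finally have "wt (insert u Z) (V - insert u Z) \<ge> wt V V / 4 + wt V V / (4 * ?n) \<or>
        wt (insert v Z) (V - insert v Z) \<ge> wt V V / 4 + wt V V / (4 * ?n)"
      by argo
    moreover have "insert u Z \<subseteq> V" "insert v Z \<subseteq> V" using Z by (auto simp: V)
    ultimately show ?thesis by blast
  qed
qed

text \<open>Summed over \<open>X\<close>, both sides of the wanted inequality give
  \<open>wt X X * wt X Y\<close>, so it cannot fail at every vertex of positive inner degree:
  vertices of inner degree 0 only contribute in the same direction.\<close>

lemma exists_movable_vertex:
  assumes "finite X" "wt X X > 0"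
  shows "\<exists>v\<in>X. sum (f v) X > 0 \<and> wt X X * sum (f v) Y \<le> wt X Y * sum (f v) X"
proof (rule ccontr)
  assume "\<not> ?thesis"
  then have none: "wt X Y * sum (f v) X < wt X X * sum (f v) Y" if "v \<in> X" "sum (f v) X > 0" for v
    using that by force
  have le: "wt X Y * sum (f v) X \<le> wt X X * sum (f v) Y" if "v \<in> X" for v
  proof (cases "sum (f v) X > 0")
    case False
    then have "sum (f v) X = 0" using sum_nonneg[of X "f v"] nonneg by force
    then show ?thesis by (simp add: wt_nonneg sum_nonneg nonneg)
  qed (use none[OF that] in simp)
  have "\<exists>v\<in>X. sum (f v) X > 0"
    using assms(2) sum_nonpos[of X "\<lambda>v. sum (f v) X"] by (force simp: wt_def)
  then have "(\<Sum>v\<in>X. wt X Y * sum (f v) X) < (\<Sum>v\<in>X. wt X X * sum (f v) Y)"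
    using assms le none by (intro sum_strict_mono_ex1) auto
  moreover have "(\<Sum>v\<in>X. wt X Y * sum (f v) X) = wt X Y * wt X X"
    "(\<Sum>v\<in>X. wt X X * sum (f v) Y) = wt X X * wt X Y"
    by (simp_all add: wt_def sum_distrib_left)
  ultimately show False by simp
qed

text \<open>Movable vertices leave \<open>X\<close> one at a time. The hypothesis that the cut
  outweighs \<open>wt X X\<close> is the invariant, and the strict decrease of \<open>X\<close>
  gives termination.\<close>

lemma rebalance:
  assumes "finite V" and D: "\<forall>v\<in>V. sum (f v) V \<le> D" and "0 \<le> D"
    and "X \<subseteq> V" and "wt X X > wt V V / 4 + D / 4" and "wt X (V - X) \<ge> wt X X"
  shows "\<exists>Z\<subseteq>V. wt Z (V - Z) \<ge> wt V V / 4 + D / 4 \<and> wt Z Z \<le> wt V V / 4 + D / 4 \<and>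
    wt (V - Z) (V - Z) \<le> wt V V / 4 + D / 4"
proof -
  have "finite X" using assms finite_subset by auto
  then show ?thesis using assms(4-)
  proof (induction X rule: finite_psubset_induct)
    case (psubset X)
    have "wt X X > 0" using psubset.prems wt_nonneg[of V V] \<open>0 \<le> D\<close> by linarith
    then obtain v where v: "v \<in> X" "sum (f v) X > 0"
      "wt X X * sum (f v) (V - X) \<le> wt X (V - X) * sum (f v) X"
      using exists_movable_vertex psubset.hyps by blast
    define x y where "x = sum (f v) X" and "y = sum (f v) (V - X)"
    let ?Z = "X - {v}"
    note move = move_vertex[OF assms(1) psubset.prems(1) v(1), folded x_def y_def]
    have xy: "x + y \<le> D" using D v psubset.prems assms(1)
      by (auto simp: x_def y_def sum.subset_diff[of X V] add.commute)
    have "0 \<le> x" "0 \<le> y" by (simp_all add: x_def y_def sum_nonneg nonneg)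
    moreover have "x \<le> wt X X / 2" using move(1) wt_nonneg[of ?Z ?Z] by simp
    moreover have "wt X X / 2 + wt (V - X) (V - X) / 2 + wt X (V - X) = wt V V / 2"
      using wt_split[OF assms(1) psubset.prems(1)] by simp
    \<comment> \<open>Inner weights are halved to pass from ordered to unordered pairs;
      \<open>D\<close> and the cut weight keep their scale.\<close>
    ultimately have est: "y \<le> 3 * x"
      "wt (V - X) (V - X) / 2 + y \<le> wt V V / 2 / 4 + D / 8"
      "wt X (V - X) + x - y \<ge> wt V V / 2 / 2 + D / 4"
      using move_estimates[of "wt X X / 2" "wt (V - X) (V - X) / 2" "wt X (V - X)" "wt V V / 2" D x y]
        psubset.prems(2,3) v(3)[folded x_def y_def] xy wt_nonneg[of V V] wt_nonneg[of "V - X" "V - X"]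
      by argo+
    have Z: "?Z \<subset> X" "?Z \<subseteq> V" using v(1) psubset.prems(1) by auto
    \<comment> \<open>If \<open>X\<close> is still too heavy after the move,
      \<open>y \<le> 3 * x\<close> preserves the invariant; otherwise the new cut already has all
      three properties.\<close>
    show ?case
    proof (cases "wt ?Z ?Z > wt V V / 4 + D / 4")
      case True
      then show ?thesis
        using psubset.prems(3) move(1,3) est(1) by (intro psubset.IH[OF Z]) auto
    next
      case False
      then show ?thesis
        using Z move(2,3) est(2,3) by (intro exI[of _ ?Z]) auto
    qed
  qed
qed

text \<open>Moving one vertex out of \<open>X\<close> cannot increase a maximum cut, so its weight
  into \<open>X\<close> is at most its weight across; summing over \<open>X\<close> gives the
  claim.\<close>

lemma maximum_cut_inner:
  assumes "finite V" "X \<subseteq> V" and max: "\<forall>Z\<subseteq>V. wt Z (V - Z) \<le> wt X (V - X)"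
  shows "wt X X \<le> wt X (V - X)"
  unfolding wt_def
proof (rule sum_mono)
  fix v assume "v \<in> X"
  then show "sum (f v) X \<le> sum (f v) (V - X)"
    using move_vertex(3)[OF assms(1,2)] max[rule_format, of "X - {v}"] assms(2) by force
qed

lemma exists_judicious_cut:
  assumes "finite V" and D: "\<forall>v\<in>V. sum (f v) V \<le> D"
    and T: "wt V V / real (card V) \<le> D"
  shows "\<exists>X\<subseteq>V. wt X (V - X) \<ge> wt V V / 4 + wt V V / (4 * real (card V)) \<and>
    wt X X \<le> wt V V / 4 + D / 4 \<and> wt (V - X) (V - X) \<le> wt V V / 4 + D / 4"
proof -
  let ?T = "wt V V / 4 + wt V V / (4 * real (card V))"
  let ?M = "wt V V / 4 + D / 4"
  \<comment> \<open>Rebalancing yields a cut of weight at least \<open>?M\<close>, which is enough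
    because the average degree is at most \<open>D\<close>.\<close>
  have T': "?T \<le> ?M" using T by simp
  have "0 \<le> D" using T wt_nonneg[of V V] by (smt (verit) divide_nonneg_nonneg of_nat_0_le_iff)
  note rebalance = rebalance[OF assms(1) D this]
  have "finite ((\<lambda>X. wt X (V - X)) ` Pow V)" (is "finite ?C") using assms(1) by simp
  moreover from this have "Max ?C \<in> ?C" by (intro Max_in) auto
  ultimately obtain X where X: "X \<subseteq> V" and max: "\<forall>Z\<subseteq>V. wt Z (V - Z) \<le> wt X (V - X)"
    using Max_ge[of ?C] by fastforce
  have cut: "wt X (V - X) \<ge> ?T"
    using exists_large_cut[OF assms(1)] max by force
  have compl: "V - (V - X) = X" using X by auto
  consider "wt X X > ?M" | "wt (V - X) (V - X) > ?M"
    | "wt X X \<le> ?M" "wt (V - X) (V - X) \<le> ?M" by linarith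
  then show ?thesis
  proof cases
    case 1
    then show ?thesis
      using rebalance[OF X 1 maximum_cut_inner[OF assms(1) X max]] T' by force
  next
    case 2
    \<comment> \<open>The complement defines the same maximum cut, so the two sides can exchange
      roles.\<close>
    have "wt (V - X) (V - X) \<le> wt (V - X) (V - (V - X))"
      using maximum_cut_inner[OF assms(1), of "V - X"] max by (simp add: compl wt_commute)
    then show ?thesis
      using rebalance[OF _ 2] T' by force
  qed (use X cut in blast)
qed

end

section \<open>Translation between weighted graphs and weight functions\<close>

context weighted_graph
begin

text \<open>The weighted adjacency matrix. Setting it to 0 off \<open>E\<close> discards the
  arbitrary values of \<open>w\<close> there and makes the diagonal vanish.\<close>

definition adj :: "'a \<Rightarrow> 'a \<Rightarrow> real" where
  "adj u v = (if {u, v} \<in> E then w {u, v} else 0)"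

lemma finite_edges: "finite E"
  by (rule finite_subset[of E "Pow V"]) (use edges finite_vertices in auto)

lemma edge_vertices: "{u, v} \<in> E \<Longrightarrow> u \<in> V \<and> v \<in> V \<and> u \<noteq> v"
  using edges[of "{u, v}"] by auto

sublocale nonneg_symmetric_weights adj
proof
  show "adj u v = adj v u" for u v by (simp add: adj_def insert_commute)
  show "adj u u = 0" for u using edge_vertices[of u u] by (auto simp: adj_def)
  show "0 \<le> adj u v" for u v by (simp add: adj_def nonneg_weight)
qed

lemma weighted_degree_eq: "weighted_degree E w v = sum (adj v) V"
proof -
  have "sum (adj v) V = sum (adj v) (neighbours E v)"
    using finite_vertices edge_vertices
    by (intro sum.mono_neutral_right) (auto simp: neighbours_def adj_def)
  also have "\<dots> = weighted_degree E w v"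
    unfolding weighted_degree_def by (rule sum.cong) (auto simp: neighbours_def adj_def)
  finally show ?thesis by simp
qed

text \<open>Induction on \<open>S\<close>: a new vertex \<open>v\<close> contributes the star of
  edges from \<open>v\<close> to \<open>S\<close>, and \<open>wt\<close> counts that star
  twice.\<close>

lemma total_weight_induced:
  assumes "finite S"
  shows "total_weight (induced_edges E S) w = wt S S / 2"
  using assms
proof (induction S)
  case empty
  have "induced_edges E {} = {}" using edges by (force simp: induced_edges_def)
  then show ?case by (simp add: total_weight_def)
next
  case (insert v S)
  let ?N = "{u \<in> S. {v, u} \<in> E}"
  have star: "e \<in> (\<lambda>u. {v, u}) ` ?N" if e: "e \<in> E" "e \<subseteq> insert v S" "\<not> e \<subseteq> S" for e
  proof -
    obtain p q where "e = {p, q}" "p \<noteq> q" using edges[OF e(1)] by (auto simp: card_2_iff)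
    with e show ?thesis by (cases "p = v") (auto simp: insert_commute)
  qed
  have "induced_edges E (insert v S) = induced_edges E S \<union> (\<lambda>u. {v, u}) ` ?N"
    using star by (auto simp: induced_edges_def)
  moreover have "induced_edges E S \<inter> (\<lambda>u. {v, u}) ` ?N = {}"
    using insert by (auto simp: induced_edges_def)
  moreover have "finite (induced_edges E S)" using finite_edges by (simp add: induced_edges_def)
  ultimately have "total_weight (induced_edges E (insert v S)) w =
      total_weight (induced_edges E S) w + sum w ((\<lambda>u. {v, u}) ` ?N)"
    using insert by (simp add: total_weight_def sum.union_disjoint)
  also have "sum w ((\<lambda>u. {v, u}) ` ?N) = (\<Sum>u\<in>?N. w {v, u})"
    by (subst sum.reindex) (auto simp: inj_on_def doubleton_eq_iff)
  also have "\<dots> = sum (adj v) S"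
    using insert by (simp add: sum.inter_filter adj_def)
  finally show ?case using insert by (simp add: wt_insert_insert)
qed

lemma total_weight_eq: "total_weight E w = wt V V / 2"
proof -
  have "induced_edges E V = E" using edges by (auto simp: induced_edges_def)
  then show ?thesis using total_weight_induced[OF finite_vertices] by simp
qed

text \<open>Obtained by subtraction: the edges split into those inside \<open>X\<close>, those
  inside \<open>V - X\<close> and the cut, and \<open>wt_split\<close> decomposes
  \<open>wt V V\<close> in the same way.\<close>

lemma cut_weight_eq:
  assumes "X \<subseteq> V"
  shows "cut_weight E w X (V - X) = wt X (V - X)"
proof -
  let ?C = "{e \<in> E. \<exists>x\<in>X. \<exists>y\<in>V - X. e = {x, y}}"
  let ?A = "induced_edges E X" and ?B = "induced_edges E (V - X)"
  have fin: "finite X" "finite (V - X)" using finite_vertices assms finite_subset by auto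
  have mem: "e \<in> ?C" if e: "e \<in> E" "\<not> e \<subseteq> X" "\<not> e \<subseteq> V - X" for e
  proof -
    obtain p q where "e = {p, q}" using edges[OF e(1)] by (auto simp: card_2_iff)
    with e edges[OF e(1)] show ?thesis
      by (cases "p \<in> X") (auto simp: doubleton_eq_iff)
  qed
  have "E = ?A \<union> ?B \<union> ?C" using mem by (auto simp: induced_edges_def)
  moreover have "?A \<inter> ?B = {}"
  proof -
    have "{} \<notin> E" using edges[of "{}"] by auto
    moreover have "e = {}" if "e \<subseteq> X" "e \<subseteq> V - X" for e using that by auto
    ultimately show ?thesis by (auto simp: induced_edges_def)
  qed
  moreover have "(?A \<union> ?B) \<inter> ?C = {}" by (auto simp: induced_edges_def)
  moreover have "finite ?A" "finite ?B" "finite ?C"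
    using finite_edges by (simp_all add: induced_edges_def)
  ultimately have "sum w E = sum w ?A + sum w ?B + sum w ?C"
    by (metis (lifting) finite_UnI sum.union_disjoint)
  then have "wt V V / 2 = wt X X / 2 + wt (V - X) (V - X) / 2 + cut_weight E w X (V - X)"
    using total_weight_eq total_weight_induced[OF fin(1)] total_weight_induced[OF fin(2)]
    by (simp add: total_weight_def cut_weight_def)
  then show ?thesis using wt_split[OF finite_vertices assms] by simp
qed

lemma avg_weighted_degree_eq: "avg_weighted_degree V E w = wt V V / real (card V)"
  by (simp add: avg_weighted_degree_def weighted_degree_eq wt_def)

lemma weighted_degree_le_max: "v \<in> V \<Longrightarrow> sum (adj v) V \<le> max_weighted_degree V E w"
  unfolding max_weighted_degree_def using finite_vertices
  by (auto simp flip: weighted_degree_eq)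

lemma avg_le_max_weighted_degree:
  assumes "V \<noteq> {}"
  shows "wt V V / real (card V) \<le> max_weighted_degree V E w"
proof -
  have "wt V V \<le> real (card V) * max_weighted_degree V E w"
    unfolding wt_def by (rule sum_bounded_above) (rule weighted_degree_le_max)
  then show ?thesis using assms finite_vertices by (simp add: field_simps card_gt_0_iff)
qed

end

theorem theorem4:
  fixes V :: "'a set" and E :: "'a set set" and w :: "'a set \<Rightarrow> real"
  assumes "weighted_graph V E w"
    and "card V \<ge> 2"
  shows "\<exists>X Y. bipartition V X Y \<and>
    cut_weight E w X Y \<ge> total_weight E w / 2 + avg_weighted_degree V E w / 4 \<and>
    max (total_weight (induced_edges E X) w) (total_weight (induced_edges E Y) w)
      \<le> total_weight E w / 4 + max_weighted_degree V E w / 8"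
proof -
  interpret weighted_graph V E w by fact
  let ?D = "max_weighted_degree V E w"
  \<comment> \<open>Both required properties in terms of \<open>wt\<close>: the average degree is
    \<open>wt V V\<close> divided by the order, and the bound on the inner weights is
    doubled.\<close>
  let ?good = "\<lambda>X. wt X (V - X) \<ge> wt V V / 4 + wt V V / (4 * real (card V)) \<and>
    wt X X \<le> wt V V / 4 + ?D / 4 \<and> wt (V - X) (V - X) \<le> wt V V / 4 + ?D / 4"
  have "V \<noteq> {}" using assms(2) by auto
  note D = avg_le_max_weighted_degree[OF this]
  obtain v where v: "v \<in> V" using \<open>V \<noteq> {}\<close> by auto
  have "V \<noteq> {v}" using assms(2) by auto
  have "\<exists>X\<subseteq>V. X \<noteq> {} \<and> X \<noteq> V \<and> ?good X"
  \<comment> \<open>With total weight 0 the cut found above might be trivial, so a single vertex is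
    split off instead; otherwise the lower bound on the cut is positive and forces both sides to be
    non-empty.\<close>
  proof (cases "wt V V = 0")
    case True
    have "?D \<ge> 0" using D True by simp
    moreover have "wt {v} {v} + wt (V - {v}) (V - {v}) + 2 * wt {v} (V - {v}) = 0"
      using wt_split[OF finite_vertices, of "{v}"] v True by simp
    ultimately have "?good {v}"
      using True wt_nonneg[of "{v}" "{v}"] wt_nonneg[of "V - {v}" "V - {v}"]
        wt_nonneg[of "{v}" "V - {v}"] by simp
    with v \<open>V \<noteq> {v}\<close> show ?thesis by blast
  next
    case False
    obtain X where X: "X \<subseteq> V" "?good X"
      using exists_judicious_cut[OF finite_vertices _ D] weighted_degree_le_max by blast
    have "wt V V > 0" using False wt_nonneg[of V V] by simp
    then have "wt V V / 4 + wt V V / (4 * real (card V)) > 0"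
      by (intro add_pos_nonneg) auto
    with X(2) have "wt X (V - X) > 0" by linarith
    then have "X \<noteq> {}" "X \<noteq> V" by auto
    with X show ?thesis by blast
  qed
  then obtain X where X: "X \<subseteq> V" "X \<noteq> {}" "X \<noteq> V" "?good X" by blast
  have "finite X" "finite (V - X)" using X(1) finite_vertices finite_subset by auto
  moreover have "bipartition V X (V - X)" using X by (auto simp: bipartition_def)
  ultimately show ?thesis
    using X(1,4) by (intro exI[of _ X] exI[of _ "V - X"])
      (simp add: cut_weight_eq total_weight_induced total_weight_eq avg_weighted_degree_eq)
qed

end
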